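(* Let $n$ be a positive integer with $n\equiv 0 \pmod 6$. Then $$\gamma(Q_n)\geq\dfrac{(n-2)2^n}{n^2-2n-2}.$$
   Context: $Q_n$ is the $n$-dimensional hypercube: its vertices are the subsets of $\{1,2,\ldots,n\}$, and two vertices are adjacent iff one is obtained from the other by adding exactly one element. For a vertex $v$, $N[v]$ is the closed neighborhood of $v$ (that is, $v$ together with its neighbors). A set $D\subseteq V(Q_n)$ is a dominating set if $\bigcup_{v\in D}N[v]=V(Q_n)$. The domination number $\gamma(Q_n)$ is the minimum cardinality of a dominating set of $Q_n$. *)

theory Defs
  imports Complex_Main
begin

text \<open>Graphs are given by a vertex set \<open>V\<close> and an adjacency predicate \<open>adj\<close>,
  of which only the restriction to \<open>V\<close> matters.\<close>

definition closed_neighborhood :: "'a set \<Rightarrow> ('a \<Rightarrow> 'a \<Rightarrow> bool) \<Rightarrow> 'a \<Rightarrow> 'a set" where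
  "closed_neighborhood V adj v = insert v {w \<in> V. adj v w}"

definition dominating_set :: "'a set \<Rightarrow> ('a \<Rightarrow> 'a \<Rightarrow> bool) \<Rightarrow> 'a set \<Rightarrow> bool" where
  "dominating_set V adj D \<longleftrightarrow> D \<subseteq> V \<and> (\<Union>v\<in>D. closed_neighborhood V adj v) = V"

text \<open>Meaningful for finite \<open>V\<close> only; then \<open>V\<close> itself is a dominating set, so the
  minimum is over a finite nonempty set of numbers (see \<open>domination_number_attained\<close>).\<close>

definition domination_number :: "'a set \<Rightarrow> ('a \<Rightarrow> 'a \<Rightarrow> bool) \<Rightarrow> nat" where
  "domination_number V adj = Min (card ` {D. dominating_set V adj D})"

definition hypercube_verts :: "nat \<Rightarrow> nat set set" where
  "hypercube_verts n = Pow {1..n}"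

definition hypercube_adj :: "nat set \<Rightarrow> nat set \<Rightarrow> bool" where
  "hypercube_adj A B \<longleftrightarrow> (\<exists>x. x \<notin> A \<and> B = insert x A) \<or> (\<exists>x. x \<notin> B \<and> A = insert x B)"

abbreviation hypercube_domination_number :: "nat \<Rightarrow> nat" where
  "hypercube_domination_number n \<equiv> domination_number (hypercube_verts n) hypercube_adj"

lemma finite_dominating_sets: "finite V \<Longrightarrow> finite {D. dominating_set V adj D}"
  by (rule finite_subset[of _ "Pow V"]) (auto simp: dominating_set_def)

lemma dominating_set_verts: "dominating_set V adj V"
  by (auto simp: dominating_set_def closed_neighborhood_def)

lemma domination_number_attained:
  assumes "finite V"
  obtains D where "dominating_set V adj D" "card D = domination_number V adj"
proof -
  have "Min (card ` {D. dominating_set V adj D}) \<in> card ` {D. dominating_set V adj D}"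
    using finite_dominating_sets[OF assms] dominating_set_verts by (intro Min_in) auto
  then show ?thesis using that by (auto simp: domination_number_def)
qed

lemma domination_number_le:
  assumes "finite V" "dominating_set V adj D"
  shows "domination_number V adj \<le> card D"
  using finite_dominating_sets[OF assms(1)] assms(2)
  by (auto simp: domination_number_def intro!: Min_le)

end

theory Submission
  imports Defs
begin

text \<open>Let \<open>excess v\<close> be the number of codewords in \<open>N[v]\<close> minus one. Double counting turns the
  bound into \<open>\<Sum>v\<notin>D. (ball_excess v - 1) \<ge> \<Sum>z. 3 * excess z - (excess z)\<^sup>2\<close>,
  where \<open>ball_excess v\<close>, the total excess on \<open>N[v]\<close>, is odd for \<open>v \<notin> D\<close> because \<open>n\<close> is even.
  This is proved by discharging: each \<open>v \<notin> D\<close> with \<open>ball_excess v \<ge> 3\<close> distributes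
  \<open>ball_excess v - 1\<close> among the vertices of excess 1 and 2 in \<open>N[v]\<close>, each of which needs 2.
  A vertex of excess 2 sees at least \<open>n - 2 \<ge> 4\<close> donors. For a vertex \<open>z\<close> of excess 1,
  \<open>3 dvd n\<close> makes the total excess at distance 1 and 2 from \<open>z\<close> divisible by 3, which
  forces enough donors in \<open>N[z]\<close>.\<close>

section \<open>Divisibility of symmetric sums\<close>

lemma even_sum_symmetric:
  fixes f :: "'a \<Rightarrow> 'a \<Rightarrow> int"
  assumes "finite I" "\<And>i j. f i j = f j i" "\<And>i. f i i = 0"
  shows "even (\<Sum>i\<in>I. \<Sum>j\<in>I. f i j)"
  using assms(1)
proof (induction I)
  case (insert a I)
  have "(\<Sum>i\<in>I. f i a) = (\<Sum>i\<in>I. f a i)" using assms(2) by (intro sum.cong) auto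
  then have "(\<Sum>i\<in>insert a I. \<Sum>j\<in>insert a I. f i j)
      = 2 * (\<Sum>i\<in>I. f a i) + (\<Sum>i\<in>I. \<Sum>j\<in>I. f i j)"
    using insert by (simp add: sum.distrib assms(3))
  then show ?case using insert.IH by (metis dvd_add dvd_triv_left)
qed simp

text \<open>Each unordered triple of distinct indices contributes six equal terms; all other terms
  vanish.\<close>

lemma six_dvd_sum_symmetric:
  fixes f :: "'a \<Rightarrow> 'a \<Rightarrow> 'a \<Rightarrow> int"
  assumes "finite I" and s1: "\<And>i j k. f i j k = f j i k" and s2: "\<And>i j k. f i j k = f i k j"
    and z: "\<And>i k. f i i k = 0"
  shows "6 dvd (\<Sum>i\<in>I. \<Sum>j\<in>I. \<Sum>k\<in>I. f i j k)"
  using assms(1)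
proof (induction I)
  case (insert a I)
  have z': "f i k i = 0" "f k i i = 0" for i k using s1 s2 z by metis+
  have r: "f i a k = f a i k" "f i j a = f a i j" for i j k using s1 s2 by metis+
  \<comment> \<open>The new terms have \<open>a\<close> in exactly one of three positions, and for
    each position the double sum over the other two indices is even.\<close>
  have "even (\<Sum>j\<in>I. \<Sum>k\<in>I. f a j k)"
    by (rule even_sum_symmetric) (use insert s2 z' in auto)
  then have "6 dvd 3 * (\<Sum>j\<in>I. \<Sum>k\<in>I. f a j k)" by presburger
  moreover have "(\<Sum>i\<in>I. 2 * (\<Sum>k\<in>I. f a i k)) = 2 * (\<Sum>i\<in>I. \<Sum>k\<in>I. f a i k)"
    by (rule sum_distrib_left[symmetric])
  then have "(\<Sum>i\<in>insert a I. \<Sum>j\<in>insert a I. \<Sum>k\<in>insert a I. f i j k)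
      = 3 * (\<Sum>j\<in>I. \<Sum>k\<in>I. f a j k) + (\<Sum>i\<in>I. \<Sum>j\<in>I. \<Sum>k\<in>I. f i j k)"
    using insert by (simp add: sum.distrib z z' r)
  ultimately show ?case using insert.IH by (metis dvd_add)
qed simp

section \<open>Local structure around a vertex of excess 1\<close>

text \<open>The code seen from a vertex \<open>z\<close> of excess 1: \<open>x0\<close>, \<open>x1\<close>, \<open>x2\<close>, \<open>x3\<close> are the indicators of
  \<open>D\<close> on the spheres of radius 0 to 3 around \<open>z\<close>, indexed by the flipped coordinates (0 when
  coordinates coincide), and \<open>e1\<close>, \<open>e2\<close> are the excesses on the spheres of radius 1 and 2.\<close>

locale local_code =
  fixes I :: "'a set" and x0 :: int and x1 :: "'a \<Rightarrow> int" and x2 :: "'a \<Rightarrow> 'a \<Rightarrow> int"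
    and x3 :: "'a \<Rightarrow> 'a \<Rightarrow> 'a \<Rightarrow> int" and e1 :: "'a \<Rightarrow> int" and e2 :: "'a \<Rightarrow> 'a \<Rightarrow> int"
  assumes fin: "finite I" and six: "6 dvd card I"
    and x0: "x0 \<in> {0, 1}" and x1: "\<And>i. x1 i \<in> {0, 1}" and x2: "\<And>i j. x2 i j \<ge> 0"
    and x2_le: "\<And>i j. x2 i j \<le> 1"
    and x3: "\<And>i j k. x3 i j k \<ge> 0" and x3_le: "\<And>i j k. x3 i j k \<le> 1"
    and x2_sym: "\<And>i j. x2 i j = x2 j i" and x2_diag: "\<And>i. x2 i i = 0"
    and x3_sym1: "\<And>i j k. x3 i j k = x3 j i k" and x3_sym2: "\<And>i j k. x3 i j k = x3 i k j"
    and x3_diag: "\<And>i k. x3 i i k = 0"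
    and e0: "x0 + sum x1 I = 2"
    and e1: "\<And>i. i \<in> I \<Longrightarrow> e1 i = x0 + x1 i + (\<Sum>j\<in>I. x2 i j) - 1"
    and e2: "\<And>i j. i \<in> I \<Longrightarrow> j \<in> I \<Longrightarrow>
      e2 i j = (if i = j then 0 else x2 i j + x1 i + x1 j + (\<Sum>k\<in>I. x3 i j k) - 1)"
    and e1_nonneg: "\<And>i. i \<in> I \<Longrightarrow> e1 i \<ge> 0"
    and e2_nonneg: "\<And>i j. i \<in> I \<Longrightarrow> j \<in> I \<Longrightarrow> e2 i j \<ge> 0"
begin

text \<open>The total excess on the ball around the \<open>i\<close>-th neighbour, without the
  contribution 1 of the centre.\<close>

definition w :: "'a \<Rightarrow> int" where "w i = e1 i + (\<Sum>j\<in>I. e2 i j)"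

text \<open>The neighbours of the centre that are donors: \<open>w i\<close> is even outside the
  code, so positivity makes the ball excess at least 3.\<close>

definition good :: "'a set" where "good = {i \<in> I. x1 i = 0 \<and> w i > 0}"

lemma x3_diag': "x3 i k i = 0" "x3 k i i = 0"
  using x3_sym1 x3_sym2 x3_diag by metis+

lemma e2_sym: "i \<in> I \<Longrightarrow> j \<in> I \<Longrightarrow> e2 i j = e2 j i"
  using e2 x2_sym[of i j] x3_sym1[of i j] by simp

lemma sum_e2:
  assumes "i \<in> I"
  shows "(\<Sum>j\<in>I. e2 i j) = (\<Sum>j\<in>I. x2 i j) + int (card I) * x1 i + sum x1 I
    + (\<Sum>j\<in>I. \<Sum>k\<in>I. x3 i j k) - int (card I) - 2 * x1 i + 1"
proof -
  \<comment> \<open>At \<open>j = i\<close> the off-diagonal formula would give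
    \<open>2 * x1 i - 1\<close> instead of 0.\<close>
  have "(\<Sum>j\<in>I. e2 i j) = (\<Sum>j\<in>I. x2 i j + x1 i + x1 j + (\<Sum>k\<in>I. x3 i j k) - 1
      - (if j = i then 2 * x1 i - 1 else 0))"
    using assms by (intro sum.cong) (auto simp: e2 x2_diag x3_diag)
  also have "\<dots> = (\<Sum>j\<in>I. x2 i j) + int (card I) * x1 i + sum x1 I
    + (\<Sum>j\<in>I. \<Sum>k\<in>I. x3 i j k) - int (card I) - 2 * x1 i + 1"
    using fin assms by (simp add: sum.distrib sum_subtractf)
  finally show ?thesis .
qed

lemma even_w:
  assumes "i \<in> I" "x1 i = 0"
  shows "even (w i)"
proof -
  have "even (\<Sum>j\<in>I. \<Sum>k\<in>I. x3 i j k)"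
    by (rule even_sum_symmetric) (use fin x3_sym2 x3_diag' in auto)
  moreover have "even (int (card I))" using six by presburger
  moreover have "w i = 2 + 2 * (\<Sum>j\<in>I. x2 i j) + (\<Sum>j\<in>I. \<Sum>k\<in>I. x3 i j k) - int (card I)"
    using assms e0 by (simp add: w_def e1 sum_e2)
  ultimately show ?thesis by simp
qed

text \<open>The weight 2 gives the pair sum the coefficient 3 and cancels the terms
  \<open>2 * sum x1 I\<close>; what remains is the triple sum and multiples of
  \<open>card I\<close>. As the double sum counts each vertex at distance 2 twice, the total excess
  at distances 1 and 2 is divisible by 3.\<close>

lemma six_dvd_excess: "6 dvd 2 * sum e1 I + (\<Sum>i\<in>I. \<Sum>j\<in>I. e2 i j)"
proof -
  define N where "N = int (card I)"
  have N: "6 dvd N" using six unfolding N_def by presburger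
  have T: "6 dvd (\<Sum>i\<in>I. \<Sum>j\<in>I. \<Sum>k\<in>I. x3 i j k)"
    by (rule six_dvd_sum_symmetric) (use fin x3_sym1 x3_sym2 x3_diag in auto)
  have "even (\<Sum>i\<in>I. \<Sum>j\<in>I. x2 i j)"
    by (rule even_sum_symmetric) (use fin x2_sym x2_diag in auto)
  then have P: "6 dvd 3 * (\<Sum>i\<in>I. \<Sum>j\<in>I. x2 i j)" by presburger
  have 1: "sum e1 I = N * x0 + sum x1 I + (\<Sum>i\<in>I. \<Sum>j\<in>I. x2 i j) - N"
    by (simp add: e1 N_def sum.distrib sum_subtractf)
  have 2: "(\<Sum>i\<in>I. \<Sum>j\<in>I. e2 i j) = (\<Sum>i\<in>I. \<Sum>j\<in>I. x2 i j) + N * sum x1 I + N * sum x1 I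
    + (\<Sum>i\<in>I. \<Sum>j\<in>I. \<Sum>k\<in>I. x3 i j k) - N * N - 2 * sum x1 I + N"
    by (simp add: sum_e2 N_def sum.distrib sum_subtractf sum_distrib_left)
  have "2 * sum e1 I + (\<Sum>i\<in>I. \<Sum>j\<in>I. e2 i j)
      = N * (2 * x0 - 1 + 2 * sum x1 I - N) + 3 * (\<Sum>i\<in>I. \<Sum>j\<in>I. x2 i j)
        + (\<Sum>i\<in>I. \<Sum>j\<in>I. \<Sum>k\<in>I. x3 i j k)"
    unfolding 1 2 by (simp add: algebra_simps)
  then show ?thesis using N T P by (metis dvd_add dvd_mult2)
qed

text \<open>\<open>w i\<close> is a sum of nonnegative terms, so it vanishes only termwise.\<close>

lemma bad:
  assumes "i \<in> I" "x1 i = 0" "i \<notin> good"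
  shows "e1 i = 0" "j \<in> I \<Longrightarrow> e2 i j = 0"
proof -
  have "w i = 0" "(\<Sum>j\<in>I. e2 i j) \<ge> 0"
    using assms e1_nonneg[of i] e2_nonneg[of i]
    by (auto simp: good_def w_def intro!: sum_nonneg antisym add_nonneg_nonneg)
  then have "e1 i = 0" "(\<Sum>j\<in>I. e2 i j) = 0" using e1_nonneg[of i] assms unfolding w_def by auto
  then show "e1 i = 0" "j \<in> I \<Longrightarrow> e2 i j = 0"
    using fin assms e2_nonneg by (auto simp: sum_nonneg_eq_0_iff)
qed

text \<open>The vertex in directions \<open>d\<close> and \<open>i\<close> has excess 0 and is
  already covered by the codeword in direction \<open>d\<close>, so no other codeword covers
  it.\<close>

lemma bad_code:
  assumes "i \<in> I" "x1 i = 0" "i \<notin> good" "d \<in> I" "x1 d = 1"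
  shows "x2 d i = 0" "k \<in> I \<Longrightarrow> x3 d i k = 0"
proof -
  have "x2 d i + (\<Sum>k\<in>I. x3 d i k) = 0"
    using bad(2)[OF assms(1-3), of d] e2_sym[of i d] e2[of d i] assms
    by (cases "d = i") auto
  moreover have "(\<Sum>k\<in>I. x3 d i k) \<ge> 0" using x3 by (intro sum_nonneg) auto
  ultimately have "x2 d i = 0" "(\<Sum>k\<in>I. x3 d i k) = 0" using x2[of d i] by auto
  then show "x2 d i = 0" "k \<in> I \<Longrightarrow> x3 d i k = 0"
    using fin x3 by (auto simp: sum_nonneg_eq_0_iff)
qed

text \<open>The same argument one sphere lower: the codeword at the centre is the only one covering
  the neighbour in direction \<open>i\<close>.\<close>

lemma bad_code_centre:
  assumes "i \<in> I" "x1 i = 0" "i \<notin> good" "x0 = 1" "j \<in> I"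
  shows "x2 i j = 0" "x2 j i = 0"
proof -
  have "(\<Sum>j\<in>I. x2 i j) = 0" using bad(1)[OF assms(1-3)] e1[of i] assms by auto
  then show "x2 i j = 0" using fin x2 assms by (auto simp: sum_nonneg_eq_0_iff)
  then show "x2 j i = 0" using x2_sym by simp
qed

text \<open>Bad directions carry no excess at all, so if \<open>good\<close> is small then every sum over \<open>I\<close>
  below collapses to at most four directions.\<close>

context
  fixes C J :: "'a set"
  assumes C: "C = {i \<in> I. x1 i = 1}" and J: "J = C \<union> good"
begin

lemma J_sub: "J \<subseteq> I" using C J by (auto simp: good_def)

lemma outside: "i \<in> I \<Longrightarrow> i \<notin> J \<Longrightarrow> x1 i = 0 \<and> i \<notin> good"
  using C J x1[of i] by auto

lemma restrict_sum:
  fixes f :: "'a \<Rightarrow> int"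
  assumes "\<And>i. i \<in> I \<Longrightarrow> x1 i = 0 \<Longrightarrow> i \<notin> good \<Longrightarrow> f i = 0"
  shows "sum f I = sum f J"
  using fin J_sub outside assms by (intro sum.mono_neutral_right) auto

lemma sum_e1_J: "sum e1 I = sum e1 J"
  by (rule restrict_sum) (use bad in auto)

lemma sum_e2_J: "i \<in> I \<Longrightarrow> (\<Sum>j\<in>I. e2 i j) = (\<Sum>j\<in>J. e2 i j)"
  by (rule restrict_sum) (use bad e2_sym in auto)

lemma six_dvd_J: "6 dvd 2 * sum e1 J + (\<Sum>i\<in>J. \<Sum>j\<in>J. e2 i j)"
proof -
  have "(\<Sum>i\<in>I. \<Sum>j\<in>I. e2 i j) = (\<Sum>i\<in>J. \<Sum>j\<in>I. e2 i j)"
    by (rule restrict_sum) (use bad in auto)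
  also have "\<dots> = (\<Sum>i\<in>J. \<Sum>j\<in>J. e2 i j)"
    by (rule sum.cong[OF refl], rule sum_e2_J) (use J_sub in auto)
  finally show ?thesis using six_dvd_excess sum_e1_J by simp
qed

lemma even_w_J: "i \<in> good \<Longrightarrow> even (e1 i + (\<Sum>j\<in>J. e2 i j))"
  using even_w[of i] sum_e2_J[of i] by (simp add: good_def w_def del: even_add)

text \<open>In this and the next two formulas a known codeword, in direction \<open>d\<close> or at
  the centre, cancels the \<open>- 1\<close> of the excess, and bad directions drop out.\<close>

lemma e1_J: "d \<in> C \<Longrightarrow> e1 d = x0 + (\<Sum>j\<in>J. x2 d j)"
  using e1[of d] restrict_sum[of "x2 d"] bad_code[of _ d] C by auto

lemma e1_J': "x0 = 1 \<Longrightarrow> i \<in> good \<Longrightarrow> e1 i = (\<Sum>j\<in>J. x2 i j)"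
  using e1[of i] restrict_sum[of "x2 i"] bad_code_centre[of _ i] by (auto simp: good_def)

lemma e2_J:
  assumes "d \<in> C" "j \<in> J" "d \<noteq> j"
  shows "e2 d j = x2 d j + x1 j + (\<Sum>k\<in>J. x3 d j k)"
proof -
  have "(\<Sum>k\<in>I. x3 d j k) = (\<Sum>k\<in>J. x3 d j k)"
    using assms C J_sub bad_code[of _ d] x3_sym2[of d j]
    by (intro restrict_sum) (auto simp: subset_iff)
  then show ?thesis using assms C J_sub e2[of d j] by auto
qed

end

text \<open>Each alternative secures 2 units for the centre: three donors including the centre
  itself, two donors with a common neighbour of excess at least 2, or the centre and a neighbour of
  excess at least 2 as donors. With at most two good directions only a few 0/1 unknowns remain, and
  \<open>six_dvd_J\<close> with \<open>even_w_J\<close> settles them.\<close>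

lemma good_directions:
  assumes "card good < 3"
  shows "(card good = 2 \<and> x0 = 0 \<and> sum e1 I > 0)
    \<or> (\<exists>i l. i \<noteq> l \<and> good = {i, l} \<and> e2 i l \<ge> 2)
    \<or> (\<exists>i. good = {i} \<and> x0 = 0 \<and> e1 i \<ge> 2)"
proof -
  define C where "C = {i \<in> I. x1 i = 1}"
  have "sum x1 I = sum x1 C"
    unfolding C_def using fin x1 by (intro sum.mono_neutral_right) auto
  also have "\<dots> = int (card C)" by (simp add: C_def)
  finally have cardC: "x0 + int (card C) = 2" using e0 by simp
  note J = C_def refl[of "C \<union> good"]
  note M = six_dvd_J[OF J] and W = even_w_J[OF J] and E1 = e1_J[OF J] and E1' = e1_J'[OF J]
    and E2 = e2_J[OF J]
  have dg: "x1 i = 0" "i \<in> I" if "i \<in> good" for i using that by (auto simp: good_def)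
  have dC: "x1 i = 1" "i \<in> I" if "i \<in> C" for i using that by (auto simp: C_def)
  have disj: "a \<noteq> i" if "a \<in> C" "i \<in> good" for a i using dg that by (auto simp: C_def)
  have e2_diag: "e2 i i = 0" if "i \<in> I" for i using e2 that by simp
  have s3: "x3 b a c = x3 a b c" "x3 a c b = x3 a b c" "x3 c a b = x3 a b c" "x3 b c a = x3 a b c"
    "x3 c b a = x3 a b c" for a b c
    using x3_sym1 x3_sym2 by metis+
  have fg: "finite good" using fin by (simp add: good_def)
  consider "good = {}" | i where "good = {i}" | i l where "good = {i, l}" "i \<noteq> l"
  proof -
    have "card good = 0 \<or> card good = 1 \<or> card good = 2" using assms by linarith
    then show thesis using that fg by (metis card_0_eq card_1_singletonE card_2_iff)
  qed
  note good_cases = this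
  \<comment> \<open>Excess 1 means two codewords in the ball: two neighbours, or the centre and one
    neighbour.\<close>
  consider "x0 = 0" "card C = 2" | "x0 = 1" "card C = 1" using x0 cardC by auto
  then show ?thesis
  proof cases
    case 1
    then obtain a b where C: "C = {a, b}" and ab: "a \<noteq> b" by (meson card_2_iff)
    have I: "a \<in> I" "b \<in> I" and xab: "x1 a = 1" "x1 b = 1" using dC C by auto
    note S = x2_sym[of b a] e2_sym[of b a] e2_diag x2_diag x3_diag x3_diag' I xab 1 ab
    from good_cases show ?thesis
    proof cases
      case 1
      have e: "e1 a = x2 a b" "e1 b = x2 a b" "e2 a b = x2 a b + 1"
        using E1[of a] E1[of b] E2[of a b] by (simp_all add: S C 1)
      \<comment> \<open>The sum is 2 modulo 6, so there must be a good direction.\<close>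
      have "2 * (e1 a + e1 b) + 2 * e2 a b = 6 * x2 a b + 2" unfolding e by simp
      moreover have "6 dvd 2 * (e1 a + e1 b) + 2 * e2 a b" using M by (simp add: S C 1 algebra_simps)
      ultimately show ?thesis by presburger
    next
      case (2 i)
      have ai: "a \<noteq> i" "b \<noteq> i" and i: "i \<in> I" "x1 i = 0" using disj[of _ i] dg[of i] C 2 by auto
      note S = S ai ai[symmetric] i x2_sym[of i a] x2_sym[of i b] e2_sym[of i a] e2_sym[of i b]
        s3[where a=a and b=b and c=i]
      have e: "e1 a = x2 a b + x2 a i" "e1 b = x2 a b + x2 b i" "e2 a b = x2 a b + 1 + x3 a b i"
        "e2 a i = x2 a i + x3 a b i" "e2 b i = x2 b i + x3 a b i"
        using E1[of a] E1[of b] E2[of a b] E2[of a i] E2[of b i] by (simp_all add: S C 2)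
      have "6 dvd 2 * (e1 a + e1 b + e1 i) + 2 * (e2 a b + e2 a i + e2 b i)"
        using M by (simp add: S C 2 algebra_simps)
      moreover have "even (e1 i + e2 a i + e2 b i)" using W[of i]
        by (simp add: S C 2 add_ac del: even_add)
      moreover have "e1 i \<ge> 0" using e1_nonneg i by simp
      moreover note x2[of a i] x2[of b i] x2_le[of a i] x2_le[of b i]
      \<comment> \<open>With \<open>s = x2 a i + x2 b i\<close>, the two divisibilities say that
        \<open>e1 i\<close> is congruent to \<open>s + 2\<close> modulo 3 and modulo 2. Since
        \<open>s\<close> is 0, 1 or 2, the values 0 and 1 are excluded.\<close>
      ultimately have "e1 i \<ge> 2" unfolding e by presburger
      then show ?thesis using 2 \<open>x0 = 0\<close> by auto
    next
      case (3 i l)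
      have ai: "a \<noteq> i" "b \<noteq> i" and i: "i \<in> I" "x1 i = 0" using disj[of _ i] dg[of i] C 3 by auto
      have al: "a \<noteq> l" "b \<noteq> l" and l: "l \<in> I" "x1 l = 0" using disj[of _ l] dg[of l] C 3 by auto
      show ?thesis
      proof (cases "sum e1 I > 0")
        case False
        then have "sum e1 I = 0" using e1_nonneg by (simp add: antisym sum_nonneg)
        then have z: "e1 j = 0" if "j \<in> I" for j
          using that fin e1_nonneg by (auto simp: sum_nonneg_eq_0_iff)
        note S = S ai ai[symmetric] i x2_sym[of i a] x2_sym[of i b] e2_sym[of i a] e2_sym[of i b]
          al al[symmetric] l x2_sym[of l a] x2_sym[of l b] e2_sym[of l a] e2_sym[of l b]
          e2_sym[of l i] s3[where a=a and b=b and c=i]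
          s3[where a=a and b=b and c=l] s3[where a=a and b=i and c=l]
          s3[where a=b and b=i and c=l] 3(2) 3(2)[symmetric]
        have "x2 a b + x2 a i + x2 a l = 0" "x2 a b + x2 b i + x2 b l = 0"
          using E1[of a] E1[of b] z[of a] z[of b] by (simp_all add: S C 3(1))
        then have "x2 a b = 0" "x2 a i = 0" "x2 a l = 0" "x2 b i = 0" "x2 b l = 0"
          using x2[of a b] x2[of a i] x2[of a l] x2[of b i] x2[of b l] by linarith+
        then have e: "e2 a b = 1 + x3 a b i + x3 a b l"
          "e2 a i = x3 a b i + x3 a i l" "e2 b i = x3 a b i + x3 b i l"
          "e2 a l = x3 a b l + x3 a i l" "e2 b l = x3 a b l + x3 b i l"
          using E2[of a b] E2[of a i] E2[of b i] E2[of a l] E2[of b l] by (simp_all add: S C 3(1))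
        have "6 dvd 2 * (e2 a b + e2 a i + e2 b i + e2 a l + e2 b l + e2 i l)"
          using M by (simp add: S z C 3(1) algebra_simps)
        moreover have "even (e2 a i + e2 b i + e2 i l)" using W[of i]
          by (simp add: S z C 3(1) add_ac del: even_add)
        moreover have "e2 i l \<ge> 0" using e2_nonneg i l by simp
        moreover note x3[of a i l] x3[of b i l] x3_le[of a i l] x3_le[of b i l]
        \<comment> \<open>The same congruence modulo 6, now for \<open>e2 i l\<close> with
          \<open>s = x3 a i l + x3 b i l\<close>.\<close>
        ultimately have "e2 i l \<ge> 2" unfolding e by presburger
        then show ?thesis using 3 by auto
      qed (use 3 \<open>x0 = 0\<close> in auto)
    qed
  next
    case 2
    then obtain a where C: "C = {a}" by (meson card_1_singletonE)
    have I: "a \<in> I" and xa: "x1 a = 1" using dC C by auto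
    note S = e2_diag x2_diag x3_diag x3_diag' I xa 2
    from good_cases show ?thesis
    proof cases
      case 1
      have "e1 a = 1" using E1[of a] by (simp_all add: S C 1)
      then show ?thesis using M by (simp add: S C 1 algebra_simps)
    next
      case (2 i)
      have ai: "a \<noteq> i" and i: "i \<in> I" "x1 i = 0" using disj[of _ i] dg[of i] C 2 by auto
      note S = S ai ai[symmetric] i x2_sym[of i a] e2_sym[of i a]
      have e: "e1 a = 1 + x2 a i" "e1 i = x2 a i" "e2 a i = x2 a i"
        using E1[of a] E1'[of i] E2[of a i] by (simp_all add: S C 2)
      \<comment> \<open>By \<open>e\<close> this sum is \<open>2 + 6 * x2 a i\<close>, a
        contradiction.\<close>
      have "6 dvd 2 * (e1 a + e1 i) + 2 * e2 a i" using M by (simp add: S C 2 algebra_simps)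
      then show ?thesis unfolding e by presburger
    next
      case (3 i l)
      have ai: "a \<noteq> i" and i: "i \<in> I" "x1 i = 0" using disj[of _ i] dg[of i] C 3 by auto
      have al: "a \<noteq> l" and l: "l \<in> I" "x1 l = 0" using disj[of _ l] dg[of l] C 3 by auto
      note S = S ai ai[symmetric] i x2_sym[of i a] e2_sym[of i a] al al[symmetric] l x2_sym[of l a]
        e2_sym[of l a] e2_sym[of l i] x2_sym[of l i] s3[where a=a and b=i and c=l] 3(2) 3(2)[symmetric]
      have e: "e1 a = 1 + x2 a i + x2 a l" "e1 i = x2 a i + x2 i l" "e1 l = x2 a l + x2 i l"
        "e2 a i = x2 a i + x3 a i l" "e2 a l = x2 a l + x3 a i l"
        using E1[of a] E1'[of i] E1'[of l] E2[of a i] E2[of a l] by (simp_all add: S C 3(1))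
      have "6 dvd 2 * (e1 a + e1 i + e1 l) + 2 * (e2 a i + e2 a l + e2 i l)"
        using M by (simp add: S C 3(1) algebra_simps)
      moreover have "even (e1 i + e2 a i + e2 i l)" using W[of i]
        by (simp add: S C 3(1) add_ac del: even_add)
      moreover have "e2 i l \<ge> 0" using e2_nonneg i l by simp
      moreover note x3[of a i l] x2[of i l] x3_le[of a i l] x2_le[of i l]
      \<comment> \<open>Again \<open>e2 i l\<close> is congruent to \<open>s + 2\<close> modulo 6,
        with \<open>s = x2 i l + x3 a i l\<close>.\<close>
      ultimately have "e2 i l \<ge> 2" unfolding e by presburger
      then show ?thesis using 3 by auto
    qed
  qed
qed

end

section \<open>Coordinate flips and balls in the hypercube\<close>

text \<open>Toggling treats adding and removing an element alike, so the neighbours of a vertex are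
  indexed by coordinates.\<close>

definition flip :: "'a \<Rightarrow> 'a set \<Rightarrow> 'a set" where
  "flip i S = (if i \<in> S then S - {i} else insert i S)"

lemma flip_flip [simp]: "flip i (flip i S) = S"
  by (auto simp: flip_def)

lemma flip_commute: "flip i (flip j S) = flip j (flip i S)"
  by (auto simp: flip_def)

lemma flip_neq [simp]: "flip i S \<noteq> S" "S \<noteq> flip i S"
  by (auto simp: flip_def)

lemma flip_eq_iff [simp]: "flip i S = flip j S \<longleftrightarrow> i = j"
  by (auto simp: flip_def split: if_splits)

definition nbhd :: "nat \<Rightarrow> nat set \<Rightarrow> nat set set" where
  "nbhd n v = insert v ((\<lambda>i. flip i v) ` {1..n})"

lemma nbhd_self: "v \<in> nbhd n v" and nbhd_flip: "i \<in> {1..n} \<Longrightarrow> flip i v \<in> nbhd n v"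
  by (auto simp: nbhd_def)

lemma nbhd_sym: "u \<in> nbhd n v \<longleftrightarrow> v \<in> nbhd n u"
proof -
  have "v \<in> nbhd n u" if "u \<in> nbhd n v" for u v
  proof (cases "u = v")
    case False
    then obtain i where i: "i \<in> {1..n}" "u = flip i v" using \<open>u \<in> nbhd n v\<close> by (auto simp: nbhd_def)
    show ?thesis using nbhd_flip[OF i(1), of u] by (simp add: i(2))
  qed (simp add: nbhd_self)
  then show ?thesis by blast
qed

lemma finite_nbhd [simp]: "finite (nbhd n v)"
  by (simp add: nbhd_def)

lemma card_nbhd [simp]: "card (nbhd n v) = n + 1"
proof -
  have "inj_on (\<lambda>i. flip i v) {1..n}" by (auto simp: inj_on_def)
  then show ?thesis by (auto simp: nbhd_def card_insert_if card_image)
qed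

lemma sum_nbhd: "sum f (nbhd n v) = f v + (\<Sum>i\<in>{1..n}. f (flip i v))"
proof -
  have "inj_on (\<lambda>i. flip i v) {1..n}" by (auto simp: inj_on_def)
  moreover have "v \<notin> (\<lambda>i. flip i v) ` {1..n}" by auto
  ultimately show ?thesis by (simp add: nbhd_def sum.reindex)
qed

lemma flip_Pow: "i \<in> A \<Longrightarrow> S \<in> Pow A \<Longrightarrow> flip i S \<in> Pow A"
  by (auto simp: flip_def)

lemma nbhd_sub: "v \<in> Pow {1..n} \<Longrightarrow> nbhd n v \<subseteq> Pow {1..n}"
  by (simp add: nbhd_def image_subset_iff flip_Pow del: Pow_iff)

text \<open>Lying in each other's ball is a symmetric relation.\<close>

lemma sum_nbhd_swap:
  "(\<Sum>v\<in>Pow {1..n}. \<Sum>u\<in>nbhd n v. f u v) = (\<Sum>u\<in>Pow {1..n}. \<Sum>v\<in>nbhd n u. f u v)"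
proof -
  have "{u \<in> Pow {1..n}. u \<in> nbhd n v} = nbhd n v" if "v \<in> Pow {1..n}" for v
    using nbhd_sub[OF that] by auto
  moreover have "{v \<in> Pow {1..n}. u \<in> nbhd n v} = nbhd n u" if "u \<in> Pow {1..n}" for u
    using nbhd_sub[OF that] by (auto simp: nbhd_sym[of u n])
  ultimately show ?thesis
    using sum.swap_restrict[of "Pow {1..n}" "Pow {1..n}" "\<lambda>v u. f u v" "\<lambda>v u. u \<in> nbhd n v"]
    by (simp del: Pow_iff)
qed

lemma closed_neighborhood_hypercube:
  assumes "v \<in> hypercube_verts n"
  shows "closed_neighborhood (hypercube_verts n) hypercube_adj v = nbhd n v"
proof (intro set_eqI iffI)
  fix w assume "w \<in> closed_neighborhood (hypercube_verts n) hypercube_adj v"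
  then have "w = v \<or> w \<subseteq> {1..n} \<and> ((\<exists>x. x \<notin> v \<and> w = insert x v) \<or> (\<exists>x. x \<notin> w \<and> v = insert x w))"
    by (simp add: closed_neighborhood_def hypercube_adj_def hypercube_verts_def)
  then consider "w = v" | x where "w \<subseteq> {1..n}" "x \<notin> v" "w = insert x v"
    | x where "x \<notin> w" "v = insert x w"
    by blast
  then show "w \<in> nbhd n v"
  proof cases
    case (2 x)
    then have "w = flip x v" "x \<in> {1..n}" by (auto simp: flip_def)
    then show ?thesis using nbhd_flip by simp
  next
    case (3 x)
    then have "w = flip x v" "x \<in> {1..n}" using assms by (auto simp: flip_def hypercube_verts_def)
    then show ?thesis using nbhd_flip by simp
  qed (simp add: nbhd_self)
next
  fix w assume w: "w \<in> nbhd n v"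
  then have "w \<in> hypercube_verts n" using nbhd_sub assms by (auto simp: hypercube_verts_def)
  moreover have "w = v \<or> hypercube_adj v w"
    using w unfolding nbhd_def hypercube_adj_def flip_def by (auto split: if_splits)
  ultimately show "w \<in> closed_neighborhood (hypercube_verts n) hypercube_adj v"
    by (auto simp: closed_neighborhood_def)
qed

section \<open>Excess of a covering code\<close>

locale covering_code =
  fixes n :: nat and D :: "nat set set"
  assumes n_pos: "n > 0" and six_dvd_n: "6 dvd n" and D_sub: "D \<subseteq> Pow {1..n}"
    and covered: "\<And>v. v \<in> Pow {1..n} \<Longrightarrow> nbhd n v \<inter> D \<noteq> {}"
begin

abbreviation "V \<equiv> Pow {1..n}"
abbreviation "N \<equiv> nbhd n"

definition ind :: "nat set \<Rightarrow> int" where "ind v = of_bool (v \<in> D)"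
definition excess :: "nat set \<Rightarrow> int" where "excess v = sum ind (N v) - 1"
definition ball_excess :: "nat set \<Rightarrow> int" where "ball_excess v = sum excess (N v)"

lemma sum_ind_nbhd: "sum ind (N v) = int (card (N v \<inter> D))"
  by (simp add: ind_def of_bool_def sum.If_cases)

lemma excess_nonneg: "v \<in> V \<Longrightarrow> excess v \<ge> 0"
  using covered[of v] by (auto simp: excess_def sum_ind_nbhd Suc_le_eq card_gt_0_iff
    simp flip: of_nat_Suc)

lemma excess_alt: "excess v = ind v + (\<Sum>i\<in>{1..n}. ind (flip i v)) - 1"
  by (simp add: excess_def sum_nbhd)

lemma excess_le_ball_excess:
  assumes "v \<in> V" "u \<in> N v"
  shows "excess u \<le> ball_excess v"
  unfolding ball_excess_def using assms nbhd_sub[OF assms(1)] excess_nonneg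
  by (intro member_le_sum) auto

text \<open>Direction \<open>i\<close> leads back from \<open>flip i z\<close> to \<open>z\<close>;
  splitting it off leaves a sum over vertices at distance 2 with zero diagonal.\<close>

lemma sum_flip_flip:
  fixes f :: "nat set \<Rightarrow> int"
  assumes "i \<in> {1..n}"
  shows "(\<Sum>j\<in>{1..n}. f (flip j (flip i z)))
    = f z + (\<Sum>j\<in>{1..n}. if i = j then 0 else f (flip j (flip i z)))"
proof -
  have "(\<Sum>j\<in>{1..n}. f (flip j (flip i z)))
    = (\<Sum>j\<in>{1..n}. (if j = i then f z else 0) + (if i = j then 0 else f (flip j (flip i z))))"
    by (intro sum.cong) auto
  then show ?thesis using assms by (simp only: sum.distrib sum.delta finite_atLeastAtMost if_True)
qed

text \<open>For \<open>v\<close> outside the code, each codeword at distance 1 or 2 lies in exactly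
  two of the balls around points of \<open>N v\<close>. The total is thus an even number minus
  \<open>n + 1\<close>, and \<open>n\<close> is even.\<close>

lemma odd_ball_excess:
  assumes "v \<notin> D"
  shows "odd (ball_excess v)"
proof -
  define x2 where "x2 i j = (if i = j then 0 else ind (flip j (flip i v)))" for i j
  have "even (\<Sum>i\<in>{1..n}. \<Sum>j\<in>{1..n}. x2 i j)"
    by (rule even_sum_symmetric) (auto simp: x2_def flip_commute)
  moreover have "excess (flip i v) = ind (flip i v) + (\<Sum>j\<in>{1..n}. x2 i j) - 1"
    if "i \<in> {1..n}" for i
    using sum_flip_flip[OF that, of ind v] assms by (simp add: excess_alt x2_def ind_def)
  then have "ball_excess v = 2 * (\<Sum>i\<in>{1..n}. ind (flip i v)) - 1
      + (\<Sum>i\<in>{1..n}. \<Sum>j\<in>{1..n}. x2 i j) - int n"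
    using assms by (simp add: ball_excess_def sum_nbhd excess_alt[of v] ind_def[of v] sum.distrib
      sum_subtractf)
  moreover have "even n" using six_dvd_n by presburger
  ultimately show ?thesis by simp
qed

lemma ball_excess_ge_1:
  assumes "v \<in> V" "v \<notin> D"
  shows "ball_excess v \<ge> 1"
proof -
  have "ball_excess v \<ge> 0"
    using excess_le_ball_excess[OF assms(1) nbhd_self] excess_nonneg[OF assms(1)] by linarith
  then show ?thesis using odd_ball_excess[OF assms(2)] by presburger
qed

lemma ball_excess_ge_3: "v \<notin> D \<Longrightarrow> ball_excess v \<ge> 2 \<Longrightarrow> ball_excess v \<ge> 3"
  using odd_ball_excess[of v] by presburger

section \<open>The discharging rule\<close>

text \<open>What donor \<open>v\<close> gives to \<open>z\<close> in its ball. If all excesses there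
  are at most 1, the rate 2/3 is affordable because \<open>2/3 * b \<le> b - 1\<close> for
  \<open>b \<ge> 3\<close>. A vertex of excess at least 2 takes at least 1 less than its excess,
  which lets every vertex of excess 1 receive a full unit.\<close>

definition share :: "nat set \<Rightarrow> nat set \<Rightarrow> real" where
  "share v z = (if ball_excess v \<ge> 3 then
      if excess z = 1 then (if \<exists>u\<in>N v. excess u \<ge> 2 then 1 else 2/3)
      else if excess z = 2 then 1/2 else 0
    else 0)"

lemma share_nonneg: "share v z \<ge> 0"
  by (simp add: share_def)

lemma sum_share_le:
  assumes v: "v \<in> V" "v \<notin> D"
  shows "(\<Sum>z\<in>N v. share v z) \<le> of_int (ball_excess v - 1)"
proof (cases "ball_excess v \<ge> 3")
  case False
  then show ?thesis using ball_excess_ge_1[OF v] by (simp add: share_def)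
next
  case big: True
  have nn: "excess z \<ge> 0" if "z \<in> N v" for z using that nbhd_sub[OF v(1)] excess_nonneg by auto
  show ?thesis
  proof (cases "\<exists>u\<in>N v. excess u \<ge> 2")
    case True
    then obtain u where u: "u \<in> N v" "excess u \<ge> 2" by blast
    \<comment> \<open>The unit to be saved is saved at \<open>u\<close>, which receives 1/2 if its
      excess is 2 and nothing if it is larger.\<close>
    have "(\<Sum>z\<in>N v. share v z) \<le> (\<Sum>z\<in>N v. of_int (excess z) - (if z = u then 1 else 0))"
    proof (rule sum_mono)
      fix z assume z: "z \<in> N v"
      have "share v z \<le> of_int (excess z)"
        using nn[OF z] by (auto simp: share_def)
      moreover have "share v u \<le> of_int (excess u) - 1"
        using u by (auto simp: share_def)
      ultimately show "share v z \<le> of_int (excess z) - (if z = u then 1 else 0)" by auto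
    qed
    then show ?thesis using u by (simp add: sum_subtractf ball_excess_def)
  next
    case False
    then have "excess z = 0 \<or> excess z = 1" if "z \<in> N v" for z using that nn[OF that] by force
    then have "(\<Sum>z\<in>N v. share v z) = (\<Sum>z\<in>N v. 2/3 * of_int (excess z))"
      using False big by (intro sum.cong) (auto simp: share_def)
    also have "\<dots> = 2/3 * of_int (ball_excess v)"
      unfolding ball_excess_def of_int_sum sum_distrib_left ..
    finally show ?thesis using big by simp
  qed
qed

lemma two_le_sum_share_of_two:
  assumes "excess z = 1" "v1 \<in> N z - D" "v2 \<in> N z - D" "v1 \<noteq> v2"
    and "\<And>v. v \<in> {v1, v2} \<Longrightarrow> ball_excess v \<ge> 3 \<and> (\<exists>u\<in>N v. excess u \<ge> 2)"
  shows "(\<Sum>v\<in>N z - D. share v z) \<ge> 2"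
proof -
  have "(\<Sum>v\<in>{v1, v2}. share v z) \<le> (\<Sum>v\<in>N z - D. share v z)"
    using assms share_nonneg by (intro sum_mono2) auto
  moreover have "(\<Sum>v\<in>{v1, v2}. share v z) = (\<Sum>v\<in>{v1, v2}. 1)"
    using assms by (intro sum.cong refl) (auto simp: share_def)
  ultimately show ?thesis using assms(4) by simp
qed

lemma two_le_sum_share_of_three:
  assumes "excess z = 1" "A \<subseteq> N z - D" "card A \<ge> 3" "\<And>v. v \<in> A \<Longrightarrow> ball_excess v \<ge> 3"
  shows "(\<Sum>v\<in>N z - D. share v z) \<ge> 2"
proof -
  have "(\<Sum>v\<in>A. 2/3) \<le> (\<Sum>v\<in>A. share v z)"
    using assms(1,4) by (intro sum_mono) (auto simp: share_def)
  moreover have "(\<Sum>v\<in>A. share v z) \<le> (\<Sum>v\<in>N z - D. share v z)"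
    using assms share_nonneg by (intro sum_mono2) auto
  ultimately show ?thesis using assms(3) by simp
qed

text \<open>The spheres around \<open>z\<close> form a \<open>local_code\<close>, whose good
  directions are donors. Three donors giving at least 2/3 each suffice; with fewer good directions
  \<open>good_directions\<close> supplies either a third donor or two donors giving 1 each.\<close>

lemma sum_share_excess_1:
  assumes z: "z \<in> V" and ez: "excess z = 1"
  shows "(\<Sum>v\<in>N z - D. share v z) \<ge> 2"
proof -
  let ?I = "{1..n}"
  define x1 where "x1 i = ind (flip i z)" for i
  define x2 where "x2 i j = (if i = j then 0 else ind (flip j (flip i z)))" for i j
  define x3 where "x3 i j k = (if i = j \<or> i = k \<or> j = k then 0
    else ind (flip k (flip j (flip i z))))" for i j k
  define e1 where "e1 i = excess (flip i z)" for i
  define e2 where "e2 i j = (if i = j then 0 else excess (flip j (flip i z)))" for i j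
  have e1: "e1 i = ind z + x1 i + (\<Sum>j\<in>?I. x2 i j) - 1" if "i \<in> ?I" for i
    using sum_flip_flip[OF that, of ind z] by (simp add: e1_def excess_alt x1_def x2_def)
  have e2: "e2 i j = x2 i j + x1 i + x1 j + (\<Sum>k\<in>?I. x3 i j k) - 1"
    if ij: "i \<in> ?I" "j \<in> ?I" "i \<noteq> j" for i j
  proof -
    let ?g = "\<lambda>k. ind (flip k (flip j (flip i z)))"
    \<comment> \<open>Flipping \<open>i\<close> or \<open>j\<close> again leads back to the first
      sphere; these two terms become \<open>x1 j\<close> and \<open>x1 i\<close>.\<close>
    have "sum ?g ?I = (\<Sum>k\<in>?I. x3 i j k + (if k = i then ?g i else 0) + (if k = j then ?g j else 0))"
      using ij by (intro sum.cong) (auto simp: x3_def)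
    also have "\<dots> = (\<Sum>k\<in>?I. x3 i j k) + ?g i + ?g j" using ij by (simp add: sum.distrib)
    also have "?g i = x1 j" by (simp add: x1_def flip_commute[of j i])
    also have "?g j = x1 i" by (simp add: x1_def)
    finally show ?thesis using ij by (simp add: e2_def excess_alt x2_def)
  qed
  have V1: "flip i z \<in> V" if "i \<in> ?I" for i by (rule flip_Pow[OF that z])
  have V2: "flip j (flip i z) \<in> V" if "i \<in> ?I" "j \<in> ?I" for i j
    by (rule flip_Pow[OF that(2) V1[OF that(1)]])
  interpret local_code ?I "ind z" x1 x2 x3 e1 e2
  proof
    show "ind z + sum x1 ?I = 2" using ez by (simp add: excess_alt x1_def)
    show "e1 i \<ge> 0" if "i \<in> ?I" for i using excess_nonneg[OF V1[OF that]] by (simp add: e1_def)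
    show "e2 i j \<ge> 0" if "i \<in> ?I" "j \<in> ?I" for i j
      using excess_nonneg[OF V2[OF that]] by (simp add: e2_def)
    show "e2 i j = (if i = j then 0 else x2 i j + x1 i + x1 j + (\<Sum>k\<in>?I. x3 i j k) - 1)"
      if "i \<in> ?I" "j \<in> ?I" for i j using e2[OF that] by (simp add: e2_def)
    show "e1 i = ind z + x1 i + (\<Sum>j\<in>?I. x2 i j) - 1" if "i \<in> ?I" for i by (rule e1[OF that])
    show "x2 i j = x2 j i" for i j by (simp add: x2_def flip_commute)
    show "x3 i j k = x3 j i k" for i j k by (auto simp: x3_def flip_commute)
    show "x3 i j k = x3 i k j" for i j k by (auto simp: x3_def flip_commute)
  qed (use six_dvd_n in \<open>auto simp: x1_def x2_def x3_def ind_def\<close>)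
  have dir: "flip i z \<in> N z - D" "ball_excess (flip i z) \<ge> 3" "i \<in> ?I" if "i \<in> good" for i
  proof -
    have i: "i \<in> ?I" "x1 i = 0" "w i > 0" using that unfolding good_def by auto
    then have nD: "flip i z \<notin> D" by (simp add: x1_def ind_def)
    have "ball_excess (flip i z) = w i + 1"
      using sum_flip_flip[OF i(1), of excess z] ez
      unfolding w_def by (simp add: ball_excess_def sum_nbhd e1_def e2_def)
    then show "ball_excess (flip i z) \<ge> 3" using ball_excess_ge_3[OF nD] i by simp
    show "flip i z \<in> N z - D" "i \<in> ?I" using nD i nbhd_flip by auto
  qed
  have centre: "z \<in> N z - D" "ball_excess z \<ge> 3" if "ind z = 0" "sum e1 ?I > 0"
  proof -
    have nD: "z \<notin> D" using that by (simp add: ind_def)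
    have "ball_excess z = 1 + sum e1 ?I" using ez by (simp add: ball_excess_def sum_nbhd e1_def)
    then show "ball_excess z \<ge> 3" using ball_excess_ge_3[OF nD] that by simp
    show "z \<in> N z - D" using nD nbhd_self by simp
  qed
  have cg: "card ((\<lambda>i. flip i z) ` good) = card good" by (intro card_image) (auto simp: inj_on_def)
  have fg: "finite good" unfolding good_def by simp
  have sub: "(\<lambda>i. flip i z) ` good \<subseteq> N z - D" using dir(1) by (rule image_subsetI)
  have big: "ball_excess v \<ge> 3" if "v \<in> (\<lambda>i. flip i z) ` good" for v using that dir(2) by blast
  show ?thesis
  proof (cases "card good < 3")
    case False
    then show ?thesis using two_le_sum_share_of_three[OF ez sub _ big] cg by simp
  next
    case True
    from good_directions[OF True] show ?thesis
    proof (elim disjE exE conjE)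
      assume *: "card good = 2" "ind z = 0" "sum e1 ?I > 0"
      have "z \<notin> (\<lambda>i. flip i z) ` good" by auto
      then have c: "card (insert z ((\<lambda>i. flip i z) ` good)) \<ge> 3" using cg fg *(1) by simp
      show ?thesis
      proof (rule two_le_sum_share_of_three[OF ez _ c])
        show "insert z ((\<lambda>i. flip i z) ` good) \<subseteq> N z - D" using sub centre(1)[OF *(2,3)] by simp
        show "ball_excess v \<ge> 3" if "v \<in> insert z ((\<lambda>i. flip i z) ` good)" for v
          using that big centre(2)[OF *(2,3)] by blast
      qed
    next
      fix i l assume il: "i \<noteq> l" "good = {i, l}" "e2 i l \<ge> 2"
      have g: "i \<in> good" "l \<in> good" unfolding il(2) by simp_all
      \<comment> \<open>The common neighbour of both donors, other than \<open>z\<close>, is the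
        vertex of large excess.\<close>
      have "flip l (flip i z) \<in> N (flip i z)" "flip l (flip i z) \<in> N (flip l z)"
        using nbhd_flip[OF dir(3)[OF g(2)], of "flip i z"]
          nbhd_flip[OF dir(3)[OF g(1)], of "flip l z"]
        by (simp_all add: flip_commute[of l i])
      moreover have "excess (flip l (flip i z)) \<ge> 2" using il(1,3) by (simp add: e2_def)
      ultimately have "\<exists>u\<in>N v. excess u \<ge> 2" if "v \<in> {flip i z, flip l z}" for v
        using that by blast
      moreover have "ball_excess v \<ge> 3" if "v \<in> {flip i z, flip l z}" for v
        using that dir(2)[OF g(1)] dir(2)[OF g(2)] by blast
      ultimately show ?thesis
        using two_le_sum_share_of_two[OF ez dir(1)[OF g(1)] dir(1)[OF g(2)]] il(1) by simp
    next
      fix i assume i: "good = {i}" "ind z = 0" "e1 i \<ge> 2"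
      have g: "i \<in> good" unfolding i(1) by simp
      have "e1 i \<le> sum e1 ?I" using dir(3)[OF g] e1_nonneg by (intro member_le_sum) auto
      then have "sum e1 ?I > 0" using i(3) by linarith
      note c = centre[OF i(2) this]
      \<comment> \<open>This vertex lies in its own ball and in that of \<open>z\<close>, so both
        donors give 1.\<close>
      have "excess (flip i z) \<ge> 2" using i(3) by (simp add: e1_def)
      then have "\<exists>u\<in>N v. excess u \<ge> 2" if "v \<in> {z, flip i z}" for v
        using that nbhd_flip[OF dir(3)[OF g], of z] nbhd_self[of "flip i z" n] by blast
      moreover have "ball_excess v \<ge> 3" if "v \<in> {z, flip i z}" for v
        using that dir(2)[OF g] c(2) by blast
      ultimately show ?thesis
        using two_le_sum_share_of_two[OF ez c(1) dir(1)[OF g]] by simp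
    qed
  qed
qed

text \<open>Three of the \<open>n + 1\<close> ball points are codewords. Each of the other
  \<open>n - 2\<close> has an odd ball excess of at least 2, hence at least 3, and gives
  1/2.\<close>

lemma sum_share_excess_2:
  assumes z: "z \<in> V" and ez: "excess z = 2"
  shows "(\<Sum>v\<in>N z - D. share v z) \<ge> 2"
proof -
  have "card (N z \<inter> D) = 3" using ez by (simp add: excess_def sum_ind_nbhd)
  then have "card (N z - D) = n - 2" by (simp add: card_Diff_subset_Int)
  moreover have "n \<ge> 6" using n_pos six_dvd_n by (rule dvd_imp_le[rotated])
  moreover have "share v z = 1/2" if v: "v \<in> N z - D" for v
  proof -
    have "v \<in> V" "z \<in> N v" using v nbhd_sub[OF z] nbhd_sym by auto
    then have "ball_excess v \<ge> 3" using excess_le_ball_excess[of v z] ez ball_excess_ge_3 v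
      by auto
    then show ?thesis using ez by (simp add: share_def)
  qed
  then have "(\<Sum>v\<in>N z - D. share v z) = (\<Sum>v\<in>N z - D. 1/2)" by (rule sum.cong[OF refl])
  ultimately show ?thesis by simp
qed

text \<open>The demand \<open>3 * e - e^2\<close> is 0, 2, 2 for \<open>e = 0, 1, 2\<close> and not
  positive from 3 on.\<close>

lemma sum_share_ge:
  assumes z: "z \<in> V"
  shows "of_int (3 * excess z - (excess z)\<^sup>2) \<le> (\<Sum>v\<in>N z - D. share v z)"
proof -
  consider "excess z = 0" | "excess z = 1" | "excess z = 2" | "excess z \<ge> 3"
    using excess_nonneg[OF z] by linarith
  then show ?thesis
  proof cases
    case 4
    then have "3 * excess z - (excess z)\<^sup>2 \<le> 0" by (simp add: power2_eq_square)
    then have "real_of_int (3 * excess z - (excess z)\<^sup>2) \<le> 0" by linarith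
    also have "0 \<le> (\<Sum>v\<in>N z - D. share v z)" using share_nonneg by (intro sum_nonneg) auto
    finally show ?thesis .
  qed (use sum_share_excess_1[OF z] sum_share_excess_2[OF z] share_nonneg in \<open>auto intro: sum_nonneg\<close>)
qed

section \<open>Double counting\<close>

lemma sum_excess: "sum excess V = (int n + 1) * int (card D) - 2 ^ n"
proof -
  have "V \<inter> D = D" using D_sub by (rule Int_absorb1)
  then have "sum ind V = int (card D)" by (simp add: ind_def of_bool_def sum.If_cases)
  moreover have "(\<Sum>v\<in>V. \<Sum>u\<in>N v. ind u) = (\<Sum>u\<in>V. \<Sum>v\<in>N u. ind u)" by (rule sum_nbhd_swap)
  ultimately show ?thesis
    by (simp add: excess_def sum_subtractf card_Pow flip: sum_distrib_left)
qed

text \<open>\<open>excess u\<close> is counted once for each non-codeword in \<open>N u\<close>, and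
  there are \<open>(n + 1) - (excess u + 1)\<close> of these.\<close>

lemma sum_ball_excess: "(\<Sum>v\<in>V - D. ball_excess v) = (\<Sum>u\<in>V. excess u * (int n - excess u))"
proof -
  have "(\<Sum>v\<in>V - D. ball_excess v) = (\<Sum>v\<in>V. (1 - ind v) * ball_excess v)"
    by (rule sum.mono_neutral_cong_left) (auto simp: ind_def)
  also have "\<dots> = (\<Sum>v\<in>V. \<Sum>u\<in>N v. (1 - ind v) * excess u)"
    by (simp add: ball_excess_def sum_distrib_left)
  also have "\<dots> = (\<Sum>u\<in>V. \<Sum>v\<in>N u. (1 - ind v) * excess u)" by (rule sum_nbhd_swap)
  also have "\<dots> = (\<Sum>u\<in>V. excess u * (int n - excess u))"
  proof (rule sum.cong[OF refl])
    fix u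
    have "(\<Sum>v\<in>N u. 1 - ind v) = int n - excess u" by (simp add: sum_subtractf excess_def)
    then show "(\<Sum>v\<in>N u. (1 - ind v) * excess u) = excess u * (int n - excess u)"
      by (simp flip: sum_distrib_right)
  qed
  finally show ?thesis .
qed

lemma sum_share_swap: "(\<Sum>v\<in>V - D. \<Sum>z\<in>N v. share v z) = (\<Sum>z\<in>V. \<Sum>v\<in>N z - D. share v z)"
proof -
  have "(\<Sum>v\<in>V - D. \<Sum>z\<in>N v. share v z) = (\<Sum>v\<in>V. \<Sum>z\<in>N v. if v \<in> D then 0 else share v z)"
    by (rule sum.mono_neutral_cong_left) auto
  also have "\<dots> = (\<Sum>z\<in>V. \<Sum>v\<in>N z. if v \<in> D then 0 else share v z)" by (rule sum_nbhd_swap)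
  also have "\<dots> = (\<Sum>z\<in>V. \<Sum>v\<in>N z - D. share v z)"
    by (intro sum.cong sum.mono_neutral_cong_right) auto
  finally show ?thesis .
qed

text \<open>The sum of squares occurs in both the demand and the supply and cancels, which leaves an
  inequality linear in the total excess.\<close>

lemma excess_bound: "int n * int (card D) \<le> (int n - 2) * sum excess V"
proof -
  have "real_of_int (\<Sum>z\<in>V. 3 * excess z - (excess z)\<^sup>2) \<le> (\<Sum>z\<in>V. \<Sum>v\<in>N z - D. share v z)"
    unfolding of_int_sum using sum_share_ge by (intro sum_mono) simp
  also have "\<dots> = (\<Sum>v\<in>V - D. \<Sum>z\<in>N v. share v z)" by (rule sum_share_swap[symmetric])
  also have "\<dots> \<le> real_of_int (\<Sum>v\<in>V - D. ball_excess v - 1)"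
    unfolding of_int_sum using sum_share_le by (intro sum_mono) auto
  finally have "(\<Sum>z\<in>V. 3 * excess z - (excess z)\<^sup>2) \<le> (\<Sum>v\<in>V - D. ball_excess v - 1)"
    by linarith
  also have "\<dots> = int n * sum excess V - (\<Sum>z\<in>V. (excess z)\<^sup>2) - int (card (V - D))"
    unfolding sum_subtractf sum_ball_excess
    by (simp add: sum_subtractf right_diff_distrib power2_eq_square sum_distrib_left mult.commute)
  also have "int (card (V - D)) = 2 ^ n - int (card D)"
  proof -
    have "finite D" "card D \<le> card V" using D_sub by (auto intro: finite_subset card_mono)
    then show ?thesis using D_sub by (simp add: card_Diff_subset card_Pow of_nat_diff)
  qed
  finally have "3 * sum excess V \<le> int n * sum excess V - 2 ^ n + int (card D)"
    by (simp add: sum_subtractf sum_distrib_left)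
  \<comment> \<open>Here \<open>2 ^ n\<close> is replaced by
    \<open>(n + 1) * card D - sum excess V\<close>.\<close>
  then show ?thesis using sum_excess by (simp add: algebra_simps)
qed

text \<open>The denominator arises as \<open>(n - 2) * (n + 1) - n\<close>.\<close>

lemma card_bound: "(real n - 2) * 2 ^ n \<le> real (card D) * ((real n)\<^sup>2 - 2 * real n - 2)"
proof -
  have "real_of_int (int n * int (card D))
      \<le> real_of_int ((int n - 2) * ((int n + 1) * int (card D) - 2 ^ n))"
    using excess_bound unfolding sum_excess of_int_le_iff .
  then show ?thesis by (simp add: algebra_simps power2_eq_square)
qed

end

section \<open>Application to a minimum dominating set\<close>

theorem theorem2:
  fixes n :: nat
  assumes "n > 0" and "n mod 6 = 0"
  shows "real (hypercube_domination_number n) \<ge> (real n - 2) * 2 ^ n / ((real n)\<^sup>2 - 2 * real n - 2)"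
proof -
  have "finite (hypercube_verts n)" by (simp add: hypercube_verts_def)
  then obtain D where D: "dominating_set (hypercube_verts n) hypercube_adj D"
    and card: "card D = hypercube_domination_number n"
    by (rule domination_number_attained)
  have sub: "D \<subseteq> hypercube_verts n" using D by (simp add: dominating_set_def)
  interpret covering_code n D
  proof
    show "nbhd n v \<inter> D \<noteq> {}" if "v \<in> Pow {1..n}" for v
    proof -
      have "v \<in> (\<Union>d\<in>D. closed_neighborhood (hypercube_verts n) hypercube_adj d)"
        using D that by (simp add: dominating_set_def hypercube_verts_def)
      then obtain d where "d \<in> D" "v \<in> nbhd n d"
        using sub closed_neighborhood_hypercube by blast
      then show ?thesis using nbhd_sym by blast
    qed
  qed (use assms sub in \<open>auto simp: hypercube_verts_def\<close>)
  \<comment> \<open>Needed for a positive denominator, so that the division can be cleared.\<close>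
  have "n \<ge> 6" using assms by presburger
  then have "6 * real n \<le> (real n)\<^sup>2" by (simp add: power2_eq_square)
  then have "(real n)\<^sup>2 - 2 * real n - 2 > 0" using \<open>n \<ge> 6\<close> by linarith
  then show ?thesis using card_bound by (simp add: card pos_divide_le_eq)
qed

end
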